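(* Consider a planar ad hoc sensor network of $(2n+1)^2$ sensors on the grid $\{-n,\dots,n\}^2$ with spacing $r_n$, a fusion center at $(0,0)$, minimum hop routing, transmission energy per link $E_{link}(r_n)=r_n^{\delta}$ with propagation loss factor $\delta\ge 2$, and per-sensor information given by the error exponent $\mathcal{K}_s$. Let $\eta=I_t/E_t$ be the energy efficiency, the ratio of the total gathered information $I_t$ to the total required energy $E_t$. For the infinite density model (fixed area and increasing node density as $n\to\infty$, so that $r_n=\Theta(n^{-1})$ and $\mathrm{density}=\Theta(n^2)$), a non-zero efficiency is possible if the decay rate of the error exponent $\mathcal{K}_s$ as a function of density is slower than $$O\left(\mathrm{density}^{(1-\delta)/2}\right).$$
   Context: Network model: the measurement of the sensor with index $(i,j)$ is delivered to the fusion center using $|i|+|j|$ hops, each of length $r_n$. The total required energy is $E_t=E_{link}(r_n)\sum_{i=-n}^{n}\sum_{j=-n}^{n}(|i|+|j|)=2n(n+1)(2n+1)E_{link}(r_n)$, and the total gathered information is $I_t=(2n+1)^2\,\mathcal{K}_s(r_n)$, the number of sensors times the information per sensor. "Non-zero efficiency" refers to the asymptotic regime $n\to\infty$: $\eta$ does not diminish to zero. Information per sensor: $\mathcal{K}_s$ is the error exponent (exponential decay rate per sample of the miss probability, at fixed false-alarm level) for Neyman-Pearson detection of a symmetric first order autoregressive Gauss-Markov random field on the 2D lattice in i.i.d. Gaussian noise. For signal-to-noise ratio SNR and edge dependence factor $\zeta\in[0,1/4]$, $$\mathcal{K}_s(\mathrm{SNR},\zeta)=\frac{1}{4\pi^2}\int_{-\pi}^{\pi}\int_{-\pi}^{\pi}\left(\frac12\log(1+q)+\frac12\frac{1}{1+q}-\frac12\right)d\omega_1\,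 d\omega_2,\quad q=\frac{\mathrm{SNR}}{(2/\pi)K(4\zeta)(1-2\zeta\cos\omega_1-2\zeta\cos\omega_2)},$$ where $K(k)=\int_0^{\pi/2}(1-k^2\sin^2\theta)^{-1/2}d\theta$ is the complete elliptic integral of the first kind; at $\zeta=1/4$, where $K(1)=\infty$, the value is $0$. The spacing determines $\zeta$ by $\zeta=g(f(r_n))$, where $\rho=f(r_n)$ is the edge correlation factor, $f$ being typically a positive, monotonically decreasing function of $r_n$, and $g$ is a monotone mapping from $\rho$ to $\zeta$ with $g(0)=0$ and $g(1)=1/4$. For given physical parameters (including SNR) one writes $\mathcal{K}_s(r_n)=\mathcal{K}_s(\mathrm{SNR},r_n)=\mathcal{K}_s(\mathrm{SNR},g(f(r_n)))$, so that $\mathcal{K}_s$ is a function of $r_n$ and hence of density. *)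

theory Defs
  imports "HOL-Analysis.Analysis" "HOL-Library.Landau_Symbols" "HOL-Real_Asymp.Real_Asymp"
begin

definition elliptic_K :: "real \<Rightarrow> real" where
  "elliptic_K k = integral {0..pi/2} (\<lambda>\<theta>. 1 / sqrt (1 - k^2 * (sin \<theta>)^2))"

definition snr_spectrum :: "real \<Rightarrow> real \<Rightarrow> real \<Rightarrow> real \<Rightarrow> real" where
  "snr_spectrum SNR \<zeta> \<omega>1 \<omega>2 =
     SNR / ((2 / pi) * elliptic_K (4 * \<zeta>) * (1 - 2 * \<zeta> * cos \<omega>1 - 2 * \<zeta> * cos \<omega>2))"

text \<open>The error exponent (per sensor) as a function of the signal-to-noise ratio and the edge
  dependence factor \<open>\<zeta> \<in> [0, 1/4]\<close>. The case \<open>\<zeta> = 1/4\<close> is separate because the complete elliptic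
  integral diverges at modulus 1, where \<^const>\<open>elliptic_K\<close> carries no meaning.\<close>

definition error_exponent :: "real \<Rightarrow> real \<Rightarrow> real" where
  "error_exponent SNR \<zeta> =
     (if \<zeta> = 1/4 then 0
      else 1 / (4 * pi^2) *
        integral {-pi..pi} (\<lambda>\<omega>1. integral {-pi..pi} (\<lambda>\<omega>2.
          let q = snr_spectrum SNR \<zeta> \<omega>1 \<omega>2
          in 1/2 * ln (1 + q) + 1/2 * (1 / (1 + q)) - 1/2)))"

definition sensor_grid :: "nat \<Rightarrow> (int \<times> int) set" where
  "sensor_grid n = {- int n..int n} \<times> {- int n..int n}"

text \<open>Under minimum hop routing to the fusion center at \<open>(0, 0)\<close>, sensor \<open>(i, j)\<close> uses
  \<open>\<bar>i\<bar> + \<bar>j\<bar>\<close> links.\<close>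

definition hops :: "int \<times> int \<Rightarrow> int" where
  "hops s = \<bar>fst s\<bar> + \<bar>snd s\<bar>"

definition link_energy :: "real \<Rightarrow> real \<Rightarrow> real" where
  "link_energy \<delta> r = r powr \<delta>"

definition total_energy :: "real \<Rightarrow> nat \<Rightarrow> real \<Rightarrow> real" where
  "total_energy \<delta> n r = link_energy \<delta> r * (\<Sum>s\<in>sensor_grid n. real_of_int (hops s))"

definition total_information :: "(real \<Rightarrow> real) \<Rightarrow> nat \<Rightarrow> real \<Rightarrow> real" where
  "total_information Ks n r = real (card (sensor_grid n)) * Ks r"

definition energy_efficiency :: "real \<Rightarrow> (real \<Rightarrow> real) \<Rightarrow> nat \<Rightarrow> real \<Rightarrow> real" where
  "energy_efficiency \<delta> Ks n r = total_information Ks n r / total_energy \<delta> n r"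

text \<open>The spacing \<open>x\<close> gives the edge correlation factor \<open>\<rho> = f x\<close>, which gives \<open>\<zeta> = g \<rho>\<close>.\<close>

definition sensor_information :: "real \<Rightarrow> (real \<Rightarrow> real) \<Rightarrow> (real \<Rightarrow> real) \<Rightarrow> real \<Rightarrow> real" where
  "sensor_information SNR f g x = error_exponent SNR (g (f x))"

text \<open>Spacing \<open>r n\<close> and node density \<open>d n\<close> of the \<open>n\<close>-th network. For \<open>n = 0\<close> there is a single
  sensor and no spacing, so \<open>r 0\<close> is unconstrained. Only the orders of growth are required; a
  square of fixed area \<open>A\<close> spanned by ever finer grids is an instance, see the lemma below.\<close>

definition infinite_density_model :: "(nat \<Rightarrow> real) \<Rightarrow> (nat \<Rightarrow> real) \<Rightarrow> bool" where
  "infinite_density_model r d \<longleftrightarrow>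
     (\<forall>n>0. r n > 0) \<and> (\<forall>n. d n > 0) \<and>
     r \<in> \<Theta>(\<lambda>n. 1 / real n) \<and> d \<in> \<Theta>(\<lambda>n. (real n)^2)"

lemma infinite_density_model_fixed_area:
  assumes "A > 0" and r: "\<And>n. n > 0 \<Longrightarrow> r n > 0 \<and> (2 * real n * r n)^2 = A"
    and d: "\<And>n. d n = real (card (sensor_grid n)) / A"
  shows "infinite_density_model r d"
proof -
  have c: "real (card (sensor_grid n)) = (2 * real n + 1)^2" for n
    by (simp add: sensor_grid_def card_cartesian_product power2_eq_square nat_add_distrib algebra_simps)
  have eq: "r n = sqrt A / (2 * real n)" if "n > 0" for n
  proof -
    have "sqrt A = 2 * real n * r n"
      using r[OF that] that by (intro real_sqrt_unique) auto
    thus ?thesis using that by simp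
  qed
  have "r \<in> \<Theta>(\<lambda>n. 1 / real n) \<longleftrightarrow> (\<lambda>n. sqrt A / (2 * real n)) \<in> \<Theta>(\<lambda>n. 1 / real n)"
    by (intro landau_theta.in_cong eventually_mono[OF eventually_gt_at_top[of 0]] eq)
  moreover have "(\<lambda>n. sqrt A / (2 * real n)) \<in> \<Theta>(\<lambda>n. 1 / real n)"
    using \<open>A > 0\<close> by real_asymp
  moreover have "d = (\<lambda>n. (2 * real n + 1)^2 / A)"
    by (simp add: fun_eq_iff d c)
  moreover have "(\<lambda>n. (2 * real n + 1)^2 / A) \<in> \<Theta>(\<lambda>n. (real n)^2)"
    using \<open>A > 0\<close> by real_asymp
  moreover have "\<forall>n. (2 * real n + 1)^2 / A > 0"
    using \<open>A > 0\<close> by (simp add: add_nonneg_eq_0_iff)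
  ultimately show ?thesis
    using r by (simp add: infinite_density_model_def)
qed

end

theory Submission
  imports Defs
begin

text \<open>The efficiency is the information per sensor divided by the energy spent per sensor. The
  latter is \<open>2 n (n + 1) / (2 n + 1) * r\<^sub>n powr \<delta>\<close>, which in the infinite density model is of
  exact order \<open>n powr (1 - \<delta>)\<close>, that is \<open>density powr ((1 - \<delta>) / 2)\<close>. Hence comparing the error
  exponent with this power of the density is the same as comparing the efficiency with a
  constant; non-negativity of the exponent turns a bound on absolute values into a bound from
  below.\<close>

text \<open>A non-integrable function has integral 0 by convention, so the bound survives. This
  allows the iterated integrals below to be bounded pointwise, without an integrability
  argument.\<close>

lemma integral_nonneg_total:
  fixes h :: "real \<Rightarrow> real"
  assumes "\<And>x. x \<in> S \<Longrightarrow> h x \<ge> 0"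
  shows "integral S h \<ge> 0"
  using assms by (cases "h integrable_on S") (auto intro: integral_nonneg simp: not_integrable_integral)

text \<open>\<open>bigtheta_powr\<close> compares powers of absolute values; eventual non-negativity
  removes them. The exponent may have either sign, as required for
  \<open>(1 - \<delta>) / 2\<close>.\<close>

lemma bigtheta_powr_nonneg:
  fixes f g :: "'a \<Rightarrow> real"
  assumes "f \<in> \<Theta>[F](g)" "eventually (\<lambda>x. f x \<ge> 0) F" "eventually (\<lambda>x. g x \<ge> 0) F"
  shows "(\<lambda>x. f x powr p) \<in> \<Theta>[F](\<lambda>x. g x powr p)"
proof -
  have "(\<lambda>x. f x powr p) \<in> \<Theta>[F](\<lambda>x. \<bar>f x\<bar> powr p)"
    using assms(2) by (intro bigthetaI_cong) (auto elim!: eventually_mono)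
  also have "(\<lambda>x. \<bar>f x\<bar> powr p) \<in> \<Theta>[F](\<lambda>x. \<bar>g x\<bar> powr p)"
    by (rule bigtheta_powr) fact
  also have "(\<lambda>x. \<bar>g x\<bar> powr p) \<in> \<Theta>[F](\<lambda>x. g x powr p)"
    using assms(3) by (intro bigthetaI_cong) (auto elim!: eventually_mono)
  finally show ?thesis .
qed

lemma elliptic_K_nonneg:
  assumes "\<bar>k\<bar> \<le> 1"
  shows "elliptic_K k \<ge> 0"
  unfolding elliptic_K_def
proof (rule integral_nonneg_total)
  fix \<theta> :: real
  have "k\<^sup>2 * (sin \<theta>)\<^sup>2 \<le> 1 * 1"
    using assms by (intro mult_mono) (auto simp: abs_square_le_1)
  \<comment> \<open>If the radicand vanishes, the quotient is \<open>1 / 0 = 0\<close>, so modulus 1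
    is covered as well.\<close>
  thus "0 \<le> 1 / sqrt (1 - k\<^sup>2 * (sin \<theta>)\<^sup>2)" by simp
qed

lemma snr_spectrum_nonneg:
  assumes "SNR \<ge> 0" "0 \<le> \<zeta>" "\<zeta> \<le> 1/4"
  shows "snr_spectrum SNR \<zeta> \<omega>1 \<omega>2 \<ge> 0"
proof -
  have "2 * \<zeta> * cos \<omega> \<le> 1/2" for \<omega>
    using mult_left_mono[of "cos \<omega>" 1 "2 * \<zeta>"] assms by simp
  from this[of \<omega>1] this[of \<omega>2] have "1 - 2 * \<zeta> * cos \<omega>1 - 2 * \<zeta> * cos \<omega>2 \<ge> 0" by simp
  thus ?thesis
    unfolding snr_spectrum_def using assms elliptic_K_nonneg[of "4 * \<zeta>"]
    by (intro divide_nonneg_nonneg mult_nonneg_nonneg) auto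
qed

lemma error_exponent_nonneg:
  assumes "SNR \<ge> 0" "0 \<le> \<zeta>" "\<zeta> \<le> 1/4"
  shows "error_exponent SNR \<zeta> \<ge> 0"
proof -
  \<comment> \<open>The integrand is the Kullback-Leibler divergence of N(0, 1) from N(0, 1 + q). It
    is non-negative by \<open>ln x \<le> x - 1\<close> at \<open>x = 1 / (1 + q)\<close>.\<close>
  have *: "1/2 * ln (1 + q) + 1/2 * (1 / (1 + q)) - 1/2 \<ge> 0" if "q \<ge> 0" for q :: real
  proof -
    have "ln (1 / (1 + q)) \<le> 1 / (1 + q) - 1"
      using that by (intro ln_le_minus_one) auto
    hence "ln (1 + q) + 1 / (1 + q) - 1 \<ge> 0"
      using that by (simp add: ln_div)
    moreover have "1/2 * ln (1 + q) + 1/2 * (1 / (1 + q)) - 1/2 = (ln (1 + q) + 1 / (1 + q) - 1) / 2"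
      by argo
    ultimately show ?thesis by linarith
  qed
  have "integral {-pi..pi} (\<lambda>\<omega>1. integral {-pi..pi} (\<lambda>\<omega>2.
          let q = snr_spectrum SNR \<zeta> \<omega>1 \<omega>2
          in 1/2 * ln (1 + q) + 1/2 * (1 / (1 + q)) - 1/2)) \<ge> 0"
    unfolding Let_def by (intro integral_nonneg_total * snr_spectrum_nonneg assms)
  thus ?thesis
    unfolding error_exponent_def by simp
qed

lemma sensor_information_nonneg:
  assumes "SNR \<ge> 0" "0 \<le> f x" "f x \<le> 1"
    and "mono_on {0..1} g" "g 0 = 0" "g 1 = 1/4"
  shows "sensor_information SNR f g x \<ge> 0"
proof -
  \<comment> \<open>Monotonicity traps the edge dependence factor between 0 and 1/4, the range
    covered by \<open>error_exponent_nonneg\<close>.\<close>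
  have "g 0 \<le> g (f x)" "g (f x) \<le> g 1"
    using assms(2,3) mono_onD[OF assms(4), of 0 "f x"] mono_onD[OF assms(4), of "f x" 1] by simp_all
  thus ?thesis
    unfolding sensor_information_def using assms(1,5,6) by (intro error_exponent_nonneg) auto
qed

lemma card_sensor_grid: "card (sensor_grid n) = (2 * n + 1)\<^sup>2"
proof -
  have "card {- int n..int n} = 2 * n + 1" by simp
  thus ?thesis by (simp only: sensor_grid_def card_cartesian_product power2_eq_square)
qed

lemma sum_abs_symmetric_interval: "(\<Sum>i=-int n..int n. \<bar>i\<bar>) = int n * (int n + 1)"
proof (induction n)
  case (Suc n)
  \<comment> \<open>The two new endpoints contribute \<open>n + 1\<close> each, and n(n + 1) + 2(n +
    1) = (n + 1)(n + 2).\<close>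
  have "{-int (Suc n)..int (Suc n)} = insert (-int (Suc n)) (insert (int (Suc n)) {-int n..int n})"
    by auto
  thus ?case using Suc by (simp add: algebra_simps)
qed simp

lemma sum_hops_sensor_grid:
  "(\<Sum>s\<in>sensor_grid n. hops s) = 2 * int n * (int n + 1) * (2 * int n + 1)"
proof -
  have "(\<Sum>s\<in>sensor_grid n. hops s) = (\<Sum>i=-int n..int n. \<Sum>j=-int n..int n. \<bar>i\<bar> + \<bar>j\<bar>)"
    by (simp add: sensor_grid_def hops_def sum.cartesian_product case_prod_unfold)
  \<comment> \<open>By symmetry both coordinates contribute equally, and each value of one
    coordinate occurs \<open>2 * n + 1\<close> times.\<close>
  also have "\<dots> = 2 * (2 * int n + 1) * (\<Sum>i=-int n..int n. \<bar>i\<bar>)"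
    by (simp add: sum.distrib ring_distribs flip: sum_distrib_left)
  finally show ?thesis by (simp add: sum_abs_symmetric_interval)
qed

definition energy_per_sensor :: "real \<Rightarrow> nat \<Rightarrow> real \<Rightarrow> real" where
  "energy_per_sensor \<delta> n r = 2 * real n * (real n + 1) / (2 * real n + 1) * r powr \<delta>"

text \<open>One factor \<open>2 * n + 1\<close> of the number of sensors cancels against the hop
  count. At \<open>n = 0\<close> both sides are divisions by zero, hence 0.\<close>

lemma energy_efficiency_eq: "energy_efficiency \<delta> Ks n r = Ks r / energy_per_sensor \<delta> n r"
proof -
  have "(\<Sum>s\<in>sensor_grid n. real_of_int (hops s)) = 2 * real n * (real n + 1) * (2 * real n + 1)"
    unfolding of_int_sum[symmetric] sum_hops_sensor_grid by simp
  moreover have "real (card (sensor_grid n)) = (2 * real n + 1) * (2 * real n + 1)"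
    by (simp add: card_sensor_grid power2_eq_square algebra_simps)
  moreover have "2 * real n + 1 \<noteq> 0" by (simp add: add_nonneg_eq_0_iff)
  ultimately show ?thesis
    by (simp add: energy_efficiency_def total_information_def total_energy_def link_energy_def
        energy_per_sensor_def mult_ac)
qed

lemma energy_per_sensor_pos: "n > 0 \<Longrightarrow> r > 0 \<Longrightarrow> energy_per_sensor \<delta> n r > 0"
  by (simp add: energy_per_sensor_def)

lemma energy_per_sensor_bigtheta:
  assumes "infinite_density_model r d"
  shows "(\<lambda>n. energy_per_sensor \<delta> n (r n)) \<in> \<Theta>(\<lambda>n. d n powr ((1 - \<delta>) / 2))"
proof -
  have r: "\<forall>\<^sub>F n in sequentially. r n \<ge> 0" and d: "\<forall>\<^sub>F n in sequentially. d n \<ge> 0"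
    using assms
    by (auto simp: infinite_density_model_def less_imp_le intro!: eventually_mono[OF eventually_gt_at_top[of 0]])
  have "(\<lambda>n. r n powr \<delta>) \<in> \<Theta>(\<lambda>n. (1 / real n) powr \<delta>)"
    using assms r by (intro bigtheta_powr_nonneg) (auto simp: infinite_density_model_def)
  moreover have "(\<lambda>n. 2 * real n * (real n + 1) / (2 * real n + 1)) \<in> \<Theta>(real)"
    by real_asymp
  ultimately have "(\<lambda>n. energy_per_sensor \<delta> n (r n)) \<in> \<Theta>(\<lambda>n. real n * (1 / real n) powr \<delta>)"
    unfolding energy_per_sensor_def by (intro landau_theta.mult)
  \<comment> \<open>For \<open>n > 0\<close> both functions equal
    \<open>n powr (1 - \<delta>)\<close>; the base is written as a square because the density has
    order \<open>n^2\<close>.\<close>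
  also have "(\<lambda>n. real n * (1 / real n) powr \<delta>) \<in> \<Theta>(\<lambda>n. ((real n)\<^sup>2) powr ((1 - \<delta>) / 2))"
  proof (rule bigthetaI_cong, rule eventually_mono[OF eventually_gt_at_top[of 0]])
    fix n :: nat assume n: "n > 0"
    have "((real n)\<^sup>2) powr ((1 - \<delta>) / 2) = (real n powr 2) powr ((1 - \<delta>) / 2)"
      using n by (simp add: powr_numeral)
    also have "\<dots> = real n powr (1 - \<delta>)"
      unfolding powr_powr by (simp add: diff_divide_distrib)
    also have "\<dots> = real n / real n powr \<delta>"
      using n by (simp add: powr_diff)
    finally show "real n * (1 / real n) powr \<delta> = ((real n)\<^sup>2) powr ((1 - \<delta>) / 2)"
      using n by (simp add: powr_divide)
  qed
  also have "(\<lambda>n. ((real n)\<^sup>2) powr ((1 - \<delta>) / 2)) \<in> \<Theta>(\<lambda>n. d n powr ((1 - \<delta>) / 2))"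
    using assms d by (intro bigtheta_powr_nonneg) (auto simp: infinite_density_model_def bigtheta_sym)
  finally show ?thesis .
qed

theorem theorem3:
  fixes SNR \<delta> :: real and f g :: "real \<Rightarrow> real" and r d :: "nat \<Rightarrow> real"
  assumes "SNR > 0" and "\<delta> \<ge> 2"
    and "\<forall>x>0. 0 < f x \<and> f x \<le> 1" and "antimono_on {0<..} f"
    and "mono_on {0..1} g" and "g 0 = 0" and "g 1 = 1/4"
    and "infinite_density_model r d"
  shows "((\<lambda>n. sensor_information SNR f g (r n)) \<notin> O(\<lambda>n. d n powr ((1 - \<delta>) / 2)) \<longrightarrow>
       \<not> (\<lambda>n. energy_efficiency \<delta> (sensor_information SNR f g) n (r n)) \<longlonglongrightarrow> 0) \<and>
    ((\<lambda>n. sensor_information SNR f g (r n)) \<in> \<omega>(\<lambda>n. d n powr ((1 - \<delta>) / 2)) \<longrightarrow>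
       (\<exists>c>0. \<forall>\<^sub>F n in sequentially.
          energy_efficiency \<delta> (sensor_information SNR f g) n (r n) \<ge> c))"
proof -
  define K where "K = (\<lambda>n. sensor_information SNR f g (r n))"
  define W where "W = (\<lambda>n. energy_per_sensor \<delta> n (r n))"
  define D where "D = (\<lambda>n. d n powr ((1 - \<delta>) / 2))"
  have r_pos: "r n > 0" if "n > 0" for n
    using assms(8) that by (simp add: infinite_density_model_def)
  have W_pos: "\<forall>\<^sub>F n in sequentially. W n > 0"
    unfolding W_def
    by (intro eventually_mono[OF eventually_gt_at_top[of 0]] energy_per_sensor_pos r_pos)
  have K_nonneg: "\<forall>\<^sub>F n in sequentially. K n \<ge> 0"
    unfolding K_def
    by (intro eventually_mono[OF eventually_gt_at_top[of 0]] sensor_information_nonneg)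
      (use assms r_pos in \<open>auto intro: less_imp_le\<close>)
  have WD: "W \<in> \<Theta>(D)"
    unfolding W_def D_def by (rule energy_per_sensor_bigtheta[OF assms(8)])
  have eff: "energy_efficiency \<delta> (sensor_information SNR f g) n (r n) = K n / W n" for n
    by (simp add: energy_efficiency_eq K_def W_def)
  \<comment> \<open>The contrapositive of the first claim: vanishing efficiency means
    \<open>K \<in> o(W)\<close>, and \<open>W\<close> has the same order as
    \<open>D\<close>.\<close>
  have "K \<in> O(D)" if "(\<lambda>n. K n / W n) \<longlonglongrightarrow> 0"
  proof -
    have "K \<in> o(W)"
      using W_pos that by (intro smalloI_tendsto) (auto elim: eventually_mono)
    thus ?thesis
      using WD landau_o.small_imp_big landau_o.big.cong_bigtheta by blast
  qed
  \<comment> \<open>Here \<open>K\<close> eventually dominates every constant multiple of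
    \<open>W\<close>; the multiple 1 already gives the witness \<open>c = 1\<close>, once the signs
    of \<open>K\<close> and \<open>W\<close> remove the norms.\<close>
  moreover have "\<exists>c>0. \<forall>\<^sub>F n in sequentially. K n / W n \<ge> c" if "K \<in> \<omega>(D)"
  proof -
    have "K \<in> \<omega>(W)"
      using that WD by (simp add: landau_omega.small.cong_bigtheta)
    hence "\<forall>\<^sub>F n in sequentially. norm (K n) \<ge> 1 * norm (W n)"
      by (rule landau_omega.smallD) simp
    with W_pos K_nonneg have "\<forall>\<^sub>F n in sequentially. K n / W n \<ge> 1"
      by eventually_elim simp
    thus ?thesis by (intro exI[of _ 1]) simp
  qed
  ultimately show ?thesis
    unfolding eff K_def[symmetric] D_def[symmetric] by blast
qed

end
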